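(* Let $t$ be a positive real number and let $G$ be a minimally $t$-tough co-chordal graph with co-diameter at least $3$. Then $G$ has a vertex of degree $\lceil 2t\rceil$.
   Context: All graphs are finite, simple, and undirected. A graph is chordal if it has no induced cycle of length at least $4$; a graph $G$ is co-chordal if its complement $\overline{G}$ is chordal. The distance between two vertices with no path between them is $\infty$; the diameter of a graph is the largest distance between any two of its vertices (so it is $\infty$ for disconnected graphs). The co-diameter of $G$ is the diameter of $\overline{G}$; in particular, the value $\infty$ is allowed. For a graph $H$, $c(H)$ denotes the number of connected components of $H$. A set $S\subseteq V(G)$ is a separator of $G$ if $c(G-S)\ge 2$. The toughness $\tau(G)$ of a graph $G$ is the minimum of $|S|/c(G-S)$ over all separators $S$ of $G$, with $\tau(G)=\infty$ if $G$ has no separators, that is, if $G$ is complete. A graph $G$ is minimally $t$-tough if $\tau(G)=t$ and $\tau(G-e)<t$ for every edge $e$ of $G$. *)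

theory Defs
  imports "Graph_Theory.Graph_Theory" Complex_Main
begin

text \<open>
  A finite simple undirected graph is a \<open>pair_graph\<close>: a finite, loop-free, symmetric
  \<open>pair_pre_digraph\<close>, in which an undirected edge \<open>uv\<close> is represented by the two arcs
  \<open>(u, v)\<close> and \<open>(v, u)\<close>.
\<close>

definition graph_complement :: "'a pair_pre_digraph \<Rightarrow> 'a pair_pre_digraph" where
  "graph_complement G =
    \<lparr>pverts = pverts G,
     parcs = {(u, v). u \<in> pverts G \<and> v \<in> pverts G \<and> u \<noteq> v \<and> (u, v) \<notin> parcs G}\<rparr>"

definition delete_edge :: "'a pair_pre_digraph \<Rightarrow> 'a \<Rightarrow> 'a \<Rightarrow> 'a pair_pre_digraph" where
  "delete_edge G u v = \<lparr>pverts = pverts G, parcs = parcs G - {(u, v), (v, u)}\<rparr>"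

text \<open>In a symmetric loop-free digraph the outgoing arcs of \<open>v\<close> correspond to its neighbours.\<close>

definition degree :: "'a pair_pre_digraph \<Rightarrow> 'a \<Rightarrow> nat" where
  "degree G v = out_degree (with_proj G) v"

text \<open>
  A cycle is given by its list of arcs in one orientation, so it has \<open>length p\<close> edges and vertex
  set \<open>fst ` set p\<close>. It is induced if the subgraph induced by its vertices has no further edges.
\<close>

definition induced_cycle :: "'a pair_pre_digraph \<Rightarrow> ('a \<times> 'a) awalk \<Rightarrow> bool" where
  "induced_cycle G p \<longleftrightarrow>
     pre_digraph.cycle (with_proj G) p \<and>
     arcs (with_proj G \<restriction> (fst ` set p)) = set p \<union> (set p)\<inverse>"

definition chordal :: "'a pair_pre_digraph \<Rightarrow> bool" where
  "chordal G \<longleftrightarrow> \<not> (\<exists>p. induced_cycle G p \<and> length p \<ge> 4)"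

definition co_chordal :: "'a pair_pre_digraph \<Rightarrow> bool" where
  "co_chordal G \<longleftrightarrow> chordal (graph_complement G)"

text \<open>The least cost of a walk with unit arc weights; it is \<open>\<infinity>\<close> if there is no walk.\<close>

definition distance :: "'a pair_pre_digraph \<Rightarrow> 'a \<Rightarrow> 'a \<Rightarrow> ereal" where
  "distance G u v = wf_digraph.\<mu> (with_proj G) (\<lambda>_. 1) u v"

definition diameter :: "'a pair_pre_digraph \<Rightarrow> ereal" where
  "diameter G = (SUP u\<in>pverts G. SUP v\<in>pverts G. distance G u v)"

definition co_diameter :: "'a pair_pre_digraph \<Rightarrow> ereal" where
  "co_diameter G = diameter (graph_complement G)"

text \<open>
  In a symmetric digraph the strongly connected components are the connected components of the
  underlying undirected graph. The graph without vertices has none.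
\<close>

definition num_components :: "('a, 'b) pre_digraph \<Rightarrow> nat" where
  "num_components H = card (pre_digraph.sccs H)"

definition components_without :: "'a pair_pre_digraph \<Rightarrow> 'a set \<Rightarrow> nat" where
  "components_without G S = num_components (with_proj G \<restriction> (pverts G - S))"

definition separator :: "'a pair_pre_digraph \<Rightarrow> 'a set \<Rightarrow> bool" where
  "separator G S \<longleftrightarrow> S \<subseteq> pverts G \<and> components_without G S \<ge> 2"

text \<open>A finite graph has only finitely many separators, so the minimum exists if there is one.\<close>

definition toughness :: "'a pair_pre_digraph \<Rightarrow> ereal" where
  "toughness G =
    (if \<exists>S. separator G S
     then ereal (Min ((\<lambda>S. real (card S) / real (components_without G S)) ` {S. separator G S}))
     else \<infinity>)"

definition minimally_tough :: "real \<Rightarrow> 'a pair_pre_digraph \<Rightarrow> bool" where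
  "minimally_tough t G \<longleftrightarrow>
     toughness G = ereal t \<and>
     (\<forall>(u, v) \<in> parcs G. toughness (delete_edge G u v) < ereal t)"

end

theory Submission
  imports Defs
begin

text \<open>
  Every vertex has degree at least \<open>2 * t\<close>: the neighbourhood of a vertex with a non-neighbour is
  a separator, and a vertex adjacent to all others has more neighbours than any separator has
  elements (\<open>degree_ge_twice_toughness\<close>). So it suffices to find a set \<open>S\<close> with fewer than
  \<open>2 * t\<close> vertices and a vertex that has at most one neighbour outside \<open>S\<close>: its degree lies between
  \<open>2 * t\<close> and \<open>card S + 1\<close>, and \<open>\<lceil>2 * t\<rceil>\<close> is the only integer there.

  Two vertices at distance at least \<open>3\<close> in the complement are neither equal nor adjacent there and
  have no common neighbour there. In \<open>G\<close> this says that they form a dominating edge \<open>uv\<close>: every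
  other vertex is adjacent to \<open>u\<close> or to \<open>v\<close>. Minimality gives a set \<open>S\<close> that violates
  \<open>t\<close>-toughness once \<open>uv\<close> is deleted. It avoids \<open>u\<close> and \<open>v\<close>, since otherwise it would already
  violate it in \<open>G\<close>; and because the edge dominates, what remains after deleting \<open>uv\<close> and \<open>S\<close>
  consists of exactly two components, one around \<open>u\<close> and one around \<open>v\<close>. Hence
  \<open>card S < 2 * t\<close> (\<open>separator_of_dominating_edge\<close>).

  Two disjoint edges with no edge between them form an induced \<open>4\<close>-cycle in the complement, so a co-chordal
  graph contains no such pair as an induced subgraph
  (\<open>co_chordal_no_two_disjoint_edges\<close>). Therefore the neighbours of \<open>u\<close> in its component, or those
  of \<open>v\<close> in its component, are pairwise non-adjacent. That component is a star, and any of its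
  leaves, or its centre if there is no leaf, is the required vertex
  (\<open>small_degree_of_independent_side\<close>).
\<close>

section \<open>Counting components\<close>

text \<open>
  Counting the classes of mutual reachability, instead of the component subgraphs, reduces all
  statements about the number of components to statements about reachability.
\<close>

lemma components_without_eq_card_scc_of:
  assumes "pair_wf_digraph G"
  shows "components_without G S =
    card (pre_digraph.scc_of (with_proj G \<restriction> (pverts G - S)) ` (pverts G - S))"
proof -
  interpret G: pair_wf_digraph G by fact
  have "wf_digraph (with_proj G \<restriction> (pverts G - S))"
    by (rule G.wellformed_induce_subgraph)
  then interpret H: wf_digraph "with_proj G \<restriction> (pverts G - S)" .
  show ?thesis
    unfolding components_without_def num_components_def
    using H.card_sccs_verts H.sccs_verts_conv_scc_of by simp
qed

lemma components_without_le_card: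
  assumes "pair_fin_digraph G"
  shows "components_without G S \<le> card (pverts G - S)"
proof -
  interpret G: pair_fin_digraph G by fact
  show ?thesis
    using components_without_eq_card_scc_of[OF G.pair_wf_digraph_axioms, of S]
      card_image_le[of "pverts G - S"] G.pair_finite_verts by simp
qed

lemma components_without_ge_2:
  assumes "pair_fin_digraph G" "x \<in> pverts G - S" "y \<in> pverts G - S"
    and "\<not> x \<rightarrow>\<^sup>*\<^bsub>with_proj G \<restriction> (pverts G - S)\<^esub> y"
  shows "components_without G S \<ge> 2"
proof -
  interpret G: pair_fin_digraph G by fact
  let ?H = "with_proj G \<restriction> (pverts G - S)"
  have "wf_digraph ?H" by (rule G.wellformed_induce_subgraph)
  then interpret H: wf_digraph ?H .
  have "y \<in> H.scc_of y"
    using assms(3) by (intro H.in_scc_of_self) simp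
  moreover have "y \<notin> H.scc_of x"
    using assms(4) by (simp add: H.scc_of_def)
  ultimately have ne: "H.scc_of x \<noteq> H.scc_of y"
    by metis
  have "card {H.scc_of x, H.scc_of y} \<le> card (H.scc_of ` (pverts G - S))"
    using assms G.pair_finite_verts by (intro card_mono) auto
  then show ?thesis
    using ne components_without_eq_card_scc_of[OF G.pair_wf_digraph_axioms, of S] by simp
qed

lemma separator_of_isolated_vertex:
  assumes "pair_fin_digraph G" "S \<subseteq> pverts G"
    and "x \<in> pverts G - S" "y \<in> pverts G - S" "x \<noteq> y"
    and iso: "\<And>z. (x, z) \<in> parcs G \<Longrightarrow> z \<in> S"
  shows "separator G S"
proof -
  let ?H = "with_proj G \<restriction> (pverts G - S)"
  have no: "(x, z) \<notin> arcs_ends ?H" for z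
    using iso by (auto simp: arcs_ends_def arc_to_ends_def)
  have "\<not> x \<rightarrow>\<^sup>*\<^bsub>?H\<^esub> y"
  proof
    assume "x \<rightarrow>\<^sup>*\<^bsub>?H\<^esub> y"
    \<comment> \<open>a walk leaving \<open>x\<close> would need a first arc, so only the empty walk remains\<close>
    then have "x = y"
      unfolding reachable_def by (cases rule: converse_rtrancl_on_cases) (use no in auto)
    with assms show False by simp
  qed
  from components_without_ge_2[OF assms(1,3,4) this] assms(2) show ?thesis
    by (simp add: separator_def)
qed

section \<open>Toughness\<close>

lemma finite_separators: "finite (pverts G) \<Longrightarrow> finite {S. separator G S}"
  by (rule finite_subset[of _ "Pow (pverts G)"]) (auto simp: separator_def)

lemma toughness_le_separator:
  assumes "finite (pverts G)" "toughness G = ereal t" "separator G S"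
  shows "t * real (components_without G S) \<le> real (card S)"
proof -
  let ?f = "\<lambda>S. real (card S) / real (components_without G S)"
  have "t = Min (?f ` {S. separator G S})"
    using assms by (auto simp: toughness_def split: if_splits)
  also have "\<dots> \<le> ?f S"
    using assms finite_separators by (intro Min_le) auto
  finally show ?thesis
    using assms(3) by (simp add: separator_def field_simps split: if_splits)
qed

lemma separator_of_toughness_less:
  assumes "finite (pverts G)" "toughness G < ereal t"
  obtains S where "separator G S" "real (card S) < t * real (components_without G S)"
proof -
  let ?f = "\<lambda>S. real (card S) / real (components_without G S)"
  have ex: "\<exists>S. separator G S" and less: "Min (?f ` {S. separator G S}) < t"
    using assms(2) by (auto simp: toughness_def split: if_splits)
  have "Min (?f ` {S. separator G S}) \<in> ?f ` {S. separator G S}"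
    using ex assms(1) finite_separators by (intro Min_in) auto
  then obtain S where "separator G S" "?f S < t"
    using less by auto
  then show ?thesis
    using that by (simp add: separator_def field_simps)
qed

lemma degree_eq_card_neighbours: "degree G v = card {w. (v, w) \<in> parcs G}"
proof -
  have "out_arcs (with_proj G) v = Pair v ` {w. (v, w) \<in> parcs G}"
    by (auto simp: out_arcs_def)
  then show ?thesis
    by (simp add: degree_def out_degree_def card_image inj_on_def)
qed

text \<open>
  The neighbourhood \<open>?N\<close> of \<open>w\<close> isolates \<open>w\<close>, so it is a separator as soon as some further vertex
  lies outside it. If there is none, \<open>w\<close> has \<open>card (pverts G) - 1\<close> neighbours. A separator \<open>S\<close>
  exists because the toughness is finite, and it leaves at least two vertices, so it is smaller
  than the neighbourhood; already \<open>card S\<close> is at least \<open>2 * t\<close>.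
\<close>

lemma degree_ge_twice_toughness:
  assumes "pair_graph G" "t > 0" "toughness G = ereal t" "w \<in> pverts G"
  shows "2 * t \<le> real (degree G w)"
proof -
  interpret G: pair_graph G by fact
  let ?N = "{z. (w, z) \<in> parcs G}"
  have N: "?N \<subseteq> pverts G" "w \<notin> ?N"
    using G.in_arcsD2 G.no_loops' by auto
  have bound: "2 * t \<le> real (card S)" if S: "separator G S" for S
  proof -
    have "t * 2 \<le> t * real (components_without G S)"
      using S \<open>t > 0\<close> by (intro mult_left_mono) (auto simp: separator_def)
    then show ?thesis
      using toughness_le_separator[OF G.pair_finite_verts assms(3) S] by simp
  qed
  show ?thesis
  proof (cases "\<exists>y \<in> pverts G. y \<noteq> w \<and> y \<notin> ?N")
    case True
    then obtain y where "y \<in> pverts G" "y \<noteq> w" "y \<notin> ?N" by blast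
    then have "separator G ?N"
      using N assms(4)
      by (intro separator_of_isolated_vertex[of _ _ w y] G.pair_fin_digraph) auto
    then show ?thesis
      using bound degree_eq_card_neighbours[of G w] by metis
  next
    case False
    then have N_eq: "?N = pverts G - {w}"
      using N by auto
    obtain S where S: "separator G S"
      using assms(3) by (auto simp: toughness_def split: if_splits)
    then have "2 \<le> card (pverts G - S)" "S \<subseteq> pverts G"
      using components_without_le_card[OF G.pair_fin_digraph, of S] by (auto simp: separator_def)
    then have "card S + 2 \<le> card (pverts G)"
      using G.pair_finite_verts by (simp add: card_Diff_subset finite_subset)
    then have "card S \<le> degree G w"
      using assms(4) G.pair_finite_verts by (simp add: degree_eq_card_neighbours N_eq)
    then show ?thesis
      using bound[OF S] by simp
  qed
qed

section \<open>Chordal complements\<close>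

text \<open>
  In the complement \<open>a\<close>, \<open>c\<close>, \<open>b\<close>, \<open>d\<close> is a cycle. Its two possible chords \<open>ab\<close> and \<open>cd\<close> are
  edges of \<open>G\<close>, hence missing in the complement, so the cycle is induced.
\<close>

lemma co_chordal_no_two_disjoint_edges:
  assumes "pair_graph G" "co_chordal G"
    and ab: "(a, b) \<in> parcs G" and cd: "(c, d) \<in> parcs G"
    and cross: "(a, c) \<notin> parcs G" "(a, d) \<notin> parcs G" "(b, c) \<notin> parcs G" "(b, d) \<notin> parcs G"
  shows False
proof -
  interpret G: pair_graph G by fact
  let ?p = "[(a, c), (c, b), (b, d), (d, a)]"
  let ?C = "graph_complement G"
  have ba: "(b, a) \<in> parcs G" and dc: "(d, c) \<in> parcs G"
    using ab cd G.arcs_symmetric by auto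
  have dist: "a \<noteq> b" "c \<noteq> d" "a \<noteq> c" "a \<noteq> d" "b \<noteq> c" "b \<noteq> d"
    using ab cd ba dc cross G.no_loops' by auto
  have verts: "a \<in> pverts G" "b \<in> pverts G" "c \<in> pverts G" "d \<in> pverts G"
    using ab cd G.in_arcsD1 G.in_arcsD2 by auto
  have cross': "(c, a) \<notin> parcs G" "(d, a) \<notin> parcs G" "(c, b) \<notin> parcs G" "(d, b) \<notin> parcs G"
    using cross G.arcs_symmetric by blast+
  note facts = dist dist[symmetric] verts cross cross' ab ba cd dc
  have "pre_digraph.cycle (with_proj ?C) ?p"
    unfolding pre_digraph.cycle_def pre_digraph.awalk_def cas_with_proj_eq awalk_verts_with_proj_eq
    using facts by (intro exI[of _ a]) (auto simp: graph_complement_def)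
  moreover have "arcs (with_proj ?C \<restriction> (fst ` set ?p)) = set ?p \<union> (set ?p)\<inverse>"
  proof -
    \<comment> \<open>on these four vertices the complement is complete bipartite, with sides \<open>{a, b}\<close> and \<open>{c, d}\<close>\<close>
    have iff: "(x, y) \<in> parcs ?C \<longleftrightarrow> x \<in> {a, b} \<and> y \<in> {c, d} \<or> x \<in> {c, d} \<and> y \<in> {a, b}"
      if "x \<in> {a, b, c, d}" "y \<in> {a, b, c, d}" for x y
      using that by (elim insertE emptyE; simp add: graph_complement_def facts)
    have "e \<in> arcs (with_proj ?C \<restriction> {a, b, c, d}) \<longleftrightarrow> e \<in> {a, b} \<times> {c, d} \<union> {c, d} \<times> {a, b}" for e
    proof (cases e)
      case (Pair x y)
      show ?thesis
      proof (cases "x \<in> {a, b, c, d} \<and> y \<in> {a, b, c, d}")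
        case True
        with iff[of x y] show ?thesis by (simp add: Pair del: insert_Times_insert)
      next
        case False
        then show ?thesis by (auto simp: Pair simp del: insert_Times_insert)
      qed
    qed
    then have "arcs (with_proj ?C \<restriction> {a, b, c, d}) = {a, b} \<times> {c, d} \<union> {c, d} \<times> {a, b}"
      by (rule set_eqI)
    moreover have "fst ` set ?p = {a, b, c, d}"
      by auto
    ultimately have "arcs (with_proj ?C \<restriction> (fst ` set ?p)) = {a, b} \<times> {c, d} \<union> {c, d} \<times> {a, b}"
      by (simp only:)
    also have "\<dots> = set ?p \<union> (set ?p)\<inverse>"
      by (intro equalityI subrelI; simp; blast)
    finally show ?thesis .
  qed
  ultimately have "induced_cycle ?C ?p"
    by (simp add: induced_cycle_def)
  with \<open>co_chordal G\<close> show False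
    unfolding co_chordal_def chordal_def by force
qed

text \<open>
  Some pair \<open>u\<close>, \<open>v\<close> has no walk of length at most \<open>2\<close> in the complement. The absence of walks of
  length \<open>0\<close> and \<open>1\<close> makes \<open>uv\<close> an edge of \<open>G\<close>, the absence of walks of length \<open>2\<close> makes it
  dominating. This includes the case that \<open>u\<close> and \<open>v\<close> lie in different components of the complement.
\<close>

lemma dominating_edge_of_co_diameter:
  assumes "pair_graph G" "co_diameter G \<ge> 3"
  obtains u v where "(u, v) \<in> parcs G"
    and "\<forall>w \<in> pverts G. w = u \<or> w = v \<or> (u, w) \<in> parcs G \<or> (v, w) \<in> parcs G"
proof -
  interpret G: pair_graph G by fact
  let ?C = "graph_complement G"
  have "wf_digraph (with_proj ?C)"
    by unfold_locales (auto simp: graph_complement_def)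
  then interpret C: wf_digraph "with_proj ?C" .
  have pC: "pverts ?C = pverts G"
    by (simp add: graph_complement_def)
  have "\<not> (\<forall>u \<in> pverts G. \<forall>v \<in> pverts G. distance ?C u v \<le> 2)"
  proof
    assume "\<forall>u \<in> pverts G. \<forall>v \<in> pverts G. distance ?C u v \<le> 2"
    then have "co_diameter G \<le> 2"
      unfolding co_diameter_def diameter_def pC by (intro SUP_least) auto
    with assms(2) have "(3::ereal) \<le> 2" by (rule order_trans)
    then show False by simp
  qed
  then obtain u v where uv: "u \<in> pverts G" "v \<in> pverts G" and far: "\<not> distance ?C u v \<le> 2"
    by blast
  have long: "\<not> length p \<le> 2" if "C.awalk u p v" for p
  proof
    assume "length p \<le> 2"
    moreover have "C.awalk_cost (\<lambda>_. 1) p = real (length p)"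
      by (induct p) auto
    ultimately have "ereal (C.awalk_cost (\<lambda>_. 1) p) \<le> 2"
      by simp
    with C.min_cost_le_walk_cost[OF that, of "\<lambda>_. 1"] have "distance ?C u v \<le> 2"
      unfolding distance_def by (rule order_trans)
    with far show False by simp
  qed
  note walk_simps = C.awalk_def pC cas_with_proj_eq
  have "u \<noteq> v"
    using long[of "[]"] uv by (auto simp: walk_simps)
  moreover have "(u, v) \<notin> parcs ?C"
    using long[of "[(u, v)]"] uv by (auto simp add: walk_simps)
  ultimately have "(u, v) \<in> parcs G"
    using uv by (simp add: graph_complement_def)
  moreover have "\<forall>w \<in> pverts G. w = u \<or> w = v \<or> (u, w) \<in> parcs G \<or> (v, w) \<in> parcs G"
  proof
    fix w
    assume w: "w \<in> pverts G"
    have "(u, w) \<notin> parcs ?C \<or> (w, v) \<notin> parcs ?C"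
      using long[of "[(u, w), (w, v)]"] uv by (auto simp add: walk_simps)
    then show "w = u \<or> w = v \<or> (u, w) \<in> parcs G \<or> (v, w) \<in> parcs G"
      using w uv G.arcs_symmetric[of w v] by (auto simp: graph_complement_def)
  qed
  ultimately show ?thesis
    by (rule that)
qed

section \<open>Deleting a dominating edge\<close>

lemma pair_graph_delete_edge:
  assumes "pair_graph G"
  shows "pair_graph (delete_edge G u v)"
proof -
  interpret G: pair_graph G by fact
  have "symmetric (with_proj (delete_edge G u v))"
    using G.arcs_symmetric by (auto simp: symmetric_def delete_edge_def intro!: symI)
  then show ?thesis
    using G.pair_finite_verts G.pair_finite_arcs G.in_arcsD1 G.in_arcsD2 G.no_loops'
    by unfold_locales (auto simp: delete_edge_def)
qed

lemma reachable_induced_arc: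
  assumes "pair_wf_digraph G" "(x, y) \<in> parcs G" "x \<in> W" "y \<in> W"
  shows "x \<rightarrow>\<^sup>*\<^bsub>with_proj G \<restriction> W\<^esub> y"
proof -
  interpret G: pair_wf_digraph G by fact
  have "wf_digraph (with_proj G \<restriction> W)" by (rule G.wellformed_induce_subgraph)
  moreover have "(x, y) \<in> arcs_ends (with_proj G \<restriction> W)"
    using assms by (auto simp: arcs_ends_def arc_to_ends_def)
  ultimately show ?thesis
    by (rule wf_digraph.reachable_adjI)
qed

lemma sym_digraph_induced:
  assumes "pair_graph G"
  shows "sym_digraph (with_proj G \<restriction> W)"
proof -
  interpret G: pair_graph G by fact
  have "symmetric (with_proj G \<restriction> W)"
    using G.arcs_symmetric
    by (auto simp: symmetric_def arcs_ends_def arc_to_ends_def intro!: symI)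
  then show ?thesis
    by (intro wf_digraph.sym_digraphI G.wellformed_induce_subgraph)
qed

text \<open>
  A set \<open>S\<close> witnessing that \<open>G\<close> without \<open>uv\<close> is less than \<open>t\<close>-tough satisfies
  \<open>card S < t * c\<close>, where \<open>c \<ge> 2\<close> is the number of components that it leaves. Since \<open>uv\<close>
  dominates, each of them contains \<open>u\<close> or \<open>v\<close>, so \<open>c = 2\<close> and the two components are those of \<open>u\<close>
  and of \<open>v\<close>.
\<close>

lemma separator_of_dominating_edge:
  assumes "pair_graph G" "minimally_tough t G"
    and uv: "(u, v) \<in> parcs G"
    and dom: "\<forall>w \<in> pverts G. w = u \<or> w = v \<or> (u, w) \<in> parcs G \<or> (v, w) \<in> parcs G"
  obtains S where "S \<subseteq> pverts G - {u, v}" "real (card S) < 2 * t"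
    and "\<not> u \<rightarrow>\<^sup>*\<^bsub>with_proj (delete_edge G u v) \<restriction> (pverts G - S)\<^esub> v"
proof -
  interpret G: pair_graph G by fact
  let ?D = "delete_edge G u v"
  interpret D: pair_graph ?D
    using assms(1) by (rule pair_graph_delete_edge)
  have pD: "pverts ?D = pverts G"
    by (simp add: delete_edge_def)
  have "toughness ?D < ereal t" and tG: "toughness G = ereal t"
    using assms(2) uv by (auto simp: minimally_tough_def)
  then obtain S where S: "separator ?D S" "real (card S) < t * real (components_without ?D S)"
    using separator_of_toughness_less[OF D.pair_finite_verts] by blast
  let ?H = "with_proj ?D \<restriction> (pverts G - S)"
  have sub: "S \<subseteq> pverts G" and two: "components_without ?D S \<ge> 2"
    using S(1) by (auto simp: separator_def pD)
  have outside: "u \<notin> S \<and> v \<notin> S"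
  proof (rule ccontr)
    assume "\<not> (u \<notin> S \<and> v \<notin> S)"
    \<comment> \<open>the deleted edge has an end in \<open>S\<close>, so its deletion does not change the graph outside \<open>S\<close>\<close>
    then have "?H = with_proj G \<restriction> (pverts G - S)"
      by (auto simp: induce_subgraph_def delete_edge_def)
    then have same: "components_without ?D S = components_without G S"
      by (simp add: components_without_def pD)
    then have "separator G S"
      using sub two by (simp add: separator_def)
    from toughness_le_separator[OF G.pair_finite_verts tG this] S(2) same show False
      by simp
  qed
  have uvG: "u \<in> pverts G" "v \<in> pverts G"
    using uv G.in_arcsD1 G.in_arcsD2 by auto
  interpret H: sym_digraph ?H
    using D.pair_graph by (rule sym_digraph_induced)
  have reach1: "x \<rightarrow>\<^sup>*\<^bsub>?H\<^esub> y"
    if "(x, y) \<in> parcs ?D" "x \<in> pverts G - S" "y \<in> pverts G - S" for x y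
    using D.pair_wf_digraph_axioms that by (rule reachable_induced_arc)
  have near: "w \<in> H.scc_of u \<or> w \<in> H.scc_of v" if w: "w \<in> pverts G - S" for w
  proof -
    have near_end: ?thesis if "x \<in> {u, v}" "(x, w) \<in> parcs G" "w \<noteq> u" "w \<noteq> v" for x
    proof -
      have "(x, w) \<in> parcs ?D" "x \<in> pverts G - S"
        using that outside uvG by (auto simp: delete_edge_def)
      with w reach1 D.arcs_symmetric have "x \<rightarrow>\<^sup>*\<^bsub>?H\<^esub> w" "w \<rightarrow>\<^sup>*\<^bsub>?H\<^esub> x"
        by blast+
      then show ?thesis
        using that(1) by (auto simp: H.scc_of_def)
    qed
    have "w \<in> H.scc_of w"
      using w by (intro H.in_scc_of_self) simp
    show ?thesis
    proof (cases "w = u \<or> w = v")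
      case True
      with \<open>w \<in> H.scc_of w\<close> show ?thesis by auto
    next
      case False
      then show ?thesis
        using dom w near_end[of u] near_end[of v] by auto
    qed
  qed
  have scc_eq: "H.scc_of x = H.scc_of y" if "x \<in> H.scc_of y" for x y
    using that by (auto simp: H.scc_of_def intro: H.reachable_trans)
  have comps: "H.scc_of ` (pverts G - S) \<subseteq> {H.scc_of u, H.scc_of v}"
    using near scc_eq by auto
  have count: "components_without ?D S = card (H.scc_of ` (pverts G - S))"
    using components_without_eq_card_scc_of[OF D.pair_wf_digraph_axioms, of S] by (simp add: pD)
  have le: "components_without ?D S \<le> card {H.scc_of u, H.scc_of v}"
    unfolding count by (rule card_mono[OF _ comps]) simp
  have "card {H.scc_of u, H.scc_of v} \<le> 2"
    by (simp add: card_insert_if)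
  with le two have eq2: "components_without ?D S = 2" "card {H.scc_of u, H.scc_of v} = 2"
    by auto
  have "\<not> u \<rightarrow>\<^sup>*\<^bsub>?H\<^esub> v"
  proof
    assume "u \<rightarrow>\<^sup>*\<^bsub>?H\<^esub> v"
    then have "H.scc_of u = H.scc_of v"
      by (intro scc_eq H.scc_ofI_reachable)
    with eq2 show False by simp
  qed
  then show thesis
    using that[of S] sub outside S(2) eq2 by auto
qed

text \<open>
  The component of \<open>u\<close> outside \<open>S\<close> consists of \<open>u\<close> and its neighbours other than \<open>v\<close>: were a
  neighbour \<open>a\<close> of \<open>u\<close> adjacent to a vertex \<open>z\<close> outside this set, then \<open>z\<close> would be \<open>v\<close> or, by
  domination, adjacent to \<open>v\<close>, and \<open>u\<close>, \<open>a\<close>, \<open>z\<close>, \<open>v\<close> would connect \<open>u\<close> to \<open>v\<close> without the edge \<open>uv\<close>.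
\<close>

lemma neighbours_closed_of_separated_edge:
  assumes "pair_graph G" "S \<subseteq> pverts G - {u, v}" and uv: "(u, v) \<in> parcs G"
    and dom: "\<forall>w \<in> pverts G. w = u \<or> w = v \<or> (u, w) \<in> parcs G \<or> (v, w) \<in> parcs G"
    and sep: "\<not> u \<rightarrow>\<^sup>*\<^bsub>with_proj (delete_edge G u v) \<restriction> (pverts G - S)\<^esub> v"
    and a: "(u, a) \<in> parcs G" "a \<notin> insert v S"
    and az: "(a, z) \<in> parcs G" "z \<notin> S"
  shows "z = u \<or> ((u, z) \<in> parcs G \<and> z \<noteq> v)"
proof (rule ccontr)
  assume contra: "\<not> ?thesis"
  interpret G: pair_graph G by fact
  let ?D = "delete_edge G u v"
  let ?H = "with_proj ?D \<restriction> (pverts G - S)"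
  interpret D: pair_graph ?D
    using assms(1) by (rule pair_graph_delete_edge)
  interpret H: sym_digraph ?H
    using D.pair_graph by (rule sym_digraph_induced)
  have verts: "u \<in> pverts G - S" "v \<in> pverts G - S" "a \<in> pverts G - S" "z \<in> pverts G - S"
    using assms(2) uv a az G.in_arcsD1 G.in_arcsD2 by blast+
  have "a \<noteq> u"
    using a(1) G.no_loops' by auto
  then have "(u, a) \<in> parcs ?D" "(a, z) \<in> parcs ?D"
    using a az by (auto simp: delete_edge_def)
  then have "u \<rightarrow>\<^sup>*\<^bsub>?H\<^esub> a" "a \<rightarrow>\<^sup>*\<^bsub>?H\<^esub> z"
    using verts by (auto intro!: reachable_induced_arc D.pair_wf_digraph_axioms)
  then have uz: "u \<rightarrow>\<^sup>*\<^bsub>?H\<^esub> z"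
    by (rule H.reachable_trans)
  then have "z \<noteq> v"
    using sep by auto
  then have "(v, z) \<in> parcs G" "z \<noteq> u"
    using contra dom verts by auto
  then have "(z, v) \<in> parcs ?D"
    using \<open>z \<noteq> v\<close> G.arcs_symmetric by (auto simp: delete_edge_def)
  then have "z \<rightarrow>\<^sup>*\<^bsub>?H\<^esub> v"
    using verts by (intro reachable_induced_arc D.pair_wf_digraph_axioms)
  with uz have "u \<rightarrow>\<^sup>*\<^bsub>?H\<^esub> v"
    by (rule H.reachable_trans)
  with sep show False by simp
qed

section \<open>Vertices of minimum degree\<close>

lemma degree_eq_of_few_neighbours:
  assumes "pair_graph G" "t > 0" "toughness G = ereal t"
    and S: "finite S" "real (card S) < 2 * t" and "w \<in> pverts G"
    and N: "{z. (w, z) \<in> parcs G} \<subseteq> insert x S"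
  shows "int (degree G w) = \<lceil>2 * t\<rceil>"
proof -
  have "degree G w \<le> card (insert x S)"
    unfolding degree_eq_card_neighbours using N S by (intro card_mono) auto
  also have "\<dots> \<le> card S + 1"
    using S by (simp add: card_insert_if)
  finally have "real (degree G w) \<le> real (card S) + 1" by linarith
  then show ?thesis
    using degree_ge_twice_toughness[OF assms(1-3) \<open>w \<in> pverts G\<close>] S(2) by linarith
qed

text \<open>
  Here \<open>x\<close> and its neighbours outside \<open>insert y S\<close> form the star: \<open>indep\<close> says that no two leaves are
  adjacent, \<open>closed\<close> that outside \<open>S\<close> a leaf is adjacent only to \<open>x\<close> and to leaves. So the neighbours of a leaf
  lie in \<open>insert x S\<close>, and without leaves those of \<open>x\<close> lie in \<open>insert y S\<close>.
\<close>

lemma small_degree_of_independent_side: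
  assumes G: "pair_graph G" "t > 0" "toughness G = ereal t"
    and S: "S \<subseteq> pverts G" "real (card S) < 2 * t" and xy: "(x, y) \<in> parcs G"
    and indep: "\<And>a b. \<lbrakk>(x, a) \<in> parcs G; a \<notin> insert y S; (x, b) \<in> parcs G; b \<notin> insert y S\<rbrakk>
      \<Longrightarrow> (a, b) \<notin> parcs G"
    and closed: "\<And>a z. \<lbrakk>(x, a) \<in> parcs G; a \<notin> insert y S; (a, z) \<in> parcs G; z \<notin> S\<rbrakk>
      \<Longrightarrow> z = x \<or> ((x, z) \<in> parcs G \<and> z \<noteq> y)"
  shows "\<exists>w \<in> pverts G. int (degree G w) = \<lceil>2 * t\<rceil>"
proof -
  interpret G: pair_graph G by fact
  have fin: "finite S"
    using S(1) G.pair_finite_verts by (rule finite_subset)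
  show ?thesis
  proof (cases "{z. (x, z) \<in> parcs G} \<subseteq> insert y S")
    case True
    moreover have "x \<in> pverts G"
      using xy G.in_arcsD1 by blast
    ultimately show ?thesis
      using degree_eq_of_few_neighbours[OF G fin S(2)] by blast
  next
    case False
    then obtain a where a: "(x, a) \<in> parcs G" "a \<notin> insert y S"
      by blast
    have "{z. (a, z) \<in> parcs G} \<subseteq> insert x S"
    proof (intro subsetI)
      fix z
      assume "z \<in> {z. (a, z) \<in> parcs G}"
      then show "z \<in> insert x S"
        using closed[OF a, of z] indep[OF a, of z] by blast
    qed
    moreover have "a \<in> pverts G"
      using a(1) G.in_arcsD2 by blast
    ultimately show ?thesis
      using degree_eq_of_few_neighbours[OF G fin S(2)] by blast
  qed
qed

theorem corollary7p5:
  fixes t :: real and G :: "'a pair_pre_digraph"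
  assumes "t > 0"
    and "pair_graph G"
    and "minimally_tough t G"
    and "co_chordal G"
    and "co_diameter G \<ge> 3"
  shows "\<exists>v \<in> pverts G. int (degree G v) = \<lceil>2 * t\<rceil>"
proof -
  interpret G: pair_graph G by fact
  obtain u v where uv: "(u, v) \<in> parcs G"
    and dom: "\<forall>w \<in> pverts G. w = u \<or> w = v \<or> (u, w) \<in> parcs G \<or> (v, w) \<in> parcs G"
    using dominating_edge_of_co_diameter[OF assms(2,5)] by blast
  obtain S where S: "S \<subseteq> pverts G - {u, v}" "real (card S) < 2 * t"
    and sep: "\<not> u \<rightarrow>\<^sup>*\<^bsub>with_proj (delete_edge G u v) \<restriction> (pverts G - S)\<^esub> v"
    using separator_of_dominating_edge[OF assms(2,3) uv dom] by blast
  have tough: "toughness G = ereal t"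
    using assms(3) by (simp add: minimally_tough_def)
  have S': "S \<subseteq> pverts G" "S \<subseteq> pverts G - {v, u}"
    using S(1) by auto
  have vu: "(v, u) \<in> parcs G"
    using uv by (rule G.arcs_symmetric)
  have dom': "\<forall>w \<in> pverts G. w = v \<or> w = u \<or> (v, w) \<in> parcs G \<or> (u, w) \<in> parcs G"
    using dom by blast
  have swap: "delete_edge G v u = delete_edge G u v"
    by (simp add: delete_edge_def insert_commute)
  have sep': "\<not> v \<rightarrow>\<^sup>*\<^bsub>with_proj (delete_edge G v u) \<restriction> (pverts G - S)\<^esub> u"
  proof -
    have "sym_digraph (with_proj (delete_edge G u v) \<restriction> (pverts G - S))"
      using assms(2) by (intro sym_digraph_induced pair_graph_delete_edge)
    then have "symmetric (with_proj (delete_edge G u v) \<restriction> (pverts G - S))"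
      by (rule sym_digraph.sym_arcs)
    from symmetric_reachable[OF this, of v u] sep show ?thesis
      unfolding swap by metis
  qed
  note closed_u = neighbours_closed_of_separated_edge[OF assms(2) S(1) uv dom sep]
  note closed_v = neighbours_closed_of_separated_edge[OF assms(2) S'(2) vu dom' sep']
  show ?thesis
  proof (cases "\<exists>a b. (u, a) \<in> parcs G \<and> a \<notin> insert v S \<and> (u, b) \<in> parcs G \<and> b \<notin> insert v S
      \<and> (a, b) \<in> parcs G")
    case False
    then show ?thesis
      by (intro small_degree_of_independent_side[OF assms(2,1) tough S'(1) S(2) uv] closed_u) blast+
  next
    case True
    then obtain a b where ab: "(u, a) \<in> parcs G" "a \<notin> insert v S" "(u, b) \<in> parcs G"
      "b \<notin> insert v S" "(a, b) \<in> parcs G"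
      by blast
    \<comment> \<open>such an edge would put \<open>y\<close> into the component of \<open>u\<close> as well as that of \<open>v\<close>\<close>
    have cross: "(x, y) \<notin> parcs G"
      if x: "(u, x) \<in> parcs G" "x \<notin> insert v S" and y: "(v, y) \<in> parcs G" "y \<notin> insert u S" for x y
    proof
      assume "(x, y) \<in> parcs G"
      with closed_u[OF x, of y] y have "(u, y) \<in> parcs G"
        by blast
      from closed_v[OF y G.arcs_symmetric[OF this]] S(1) uv show False
        using G.no_loops' by blast
    qed
    have "(c, d) \<notin> parcs G"
      if c: "(v, c) \<in> parcs G" "c \<notin> insert u S" and d: "(v, d) \<in> parcs G" "d \<notin> insert u S" for c d
      using co_chordal_no_two_disjoint_edges[OF assms(2,4) ab(5)] cross[OF ab(1,2)] cross[OF ab(3,4)]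
        c d by blast
    then show ?thesis
      by (intro small_degree_of_independent_side[OF assms(2,1) tough S'(1) S(2) vu] closed_v) blast+
  qed
qed

end
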